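(* Let $q=2^n$ with $n\ge 3$, let $h$ be a positive integer with $\gcd(n,h)=1$, and let $\mathcal A\subset\mathrm{PG}(3,q)$ and the classes of planes $\mathcal O_d^{\mathfrak s}$, $d\in\{0,1,2,3,q+1\}$, be as defined in the context. Through every point of $\mathcal A$ there pass exactly $r_{q+1,d}$ planes of $\mathcal O_d^{\mathfrak s}$, where $$r_{q+1,d}=\begin{cases}1&\text{if } d=q+1,\\ 0&\text{if } d=0,\\ \frac{q(q-1)}2&\text{if } d\in\{1,3\},\\ 2q&\text{if } d=2.\end{cases}$$
   Context: Points of $\mathrm{PG}(3,q)$ have homogeneous coordinates $(X_1,X_2,X_3,X_4)$; $U_i$ is the point with $1$ in position $i$ and $0$ elsewhere. $\mathcal A=\{P_t=(1,t,t^{2^h},t^{2^h+1})\mid t\in\mathbb F_q\}\cup\{U_4\}$. $\mathfrak s$ is the symplectic polarity of $\mathrm{PG}(3,q)$ defined by the alternating form $x_1y_4+x_2y_3+x_3y_2+x_4y_1$. The osculating planes are the $q+1$ planes $P^{\mathfrak s}$, $P\in\mathcal A$. Put $\mathcal O_{q+1}=\mathcal A$; for $i\in\{0,1,2,3\}$, $\mathcal O_i$ is the set of points of $\mathrm{PG}(3,q)\setminus\mathcal A$ lying on exactly $i$ osculating planes. For $i\in\{0,1,2,3,q+1\}$, $\mathcal O_i^{\mathfrak s}=\{P^{\mathfrak s}\mid P\in\mathcal O_i\}$ (so $\mathcal O_{q+1}^{\mathfrak s}$ is the set of osculating planes). *)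

theory Defs
  imports "HOL-Analysis.Analysis"
begin

text \<open>
  The projective space $PG(3,q)$ over the field \<open>'a\<close>, $q = |$\<open>'a\<close>$|$, is the lattice of subspaces of
  \<open>'a ^ 4\<close>: points are the one-dimensional subspaces, planes the three-dimensional ones, and
  incidence is inclusion. The index type \<open>4\<close> consists of \<open>1\<close>, \<open>2\<close>, \<open>3\<close> and \<open>4 = 0\<close>.
\<close>

definition pg_points :: "('a::field ^ 4) set set"
  where "pg_points = {V. vec.subspace V \<and> vec.dim V = 1}"

definition pg_point :: "'a::field \<Rightarrow> 'a \<Rightarrow> 'a \<Rightarrow> 'a \<Rightarrow> ('a ^ 4) set"
  where "pg_point a b c d = vec.span {vector [a, b, c, d]}"

lemma vector_4 [simp]:
  "(vector [a, b, c, d] :: 'a::zero ^ 4) $ 1 = a"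
  "(vector [a, b, c, d] :: 'a::zero ^ 4) $ 2 = b"
  "(vector [a, b, c, d] :: 'a::zero ^ 4) $ 3 = c"
  "(vector [a, b, c, d] :: 'a::zero ^ 4) $ 4 = d"
  unfolding vector_def by simp_all

definition pg_arc :: "nat \<Rightarrow> ('a::field ^ 4) set set"
  where "pg_arc h = range (\<lambda>t. pg_point 1 t (t ^ (2 ^ h)) (t ^ (2 ^ h + 1))) \<union> {pg_point 0 0 0 1}"

text \<open>This form is alternating in characteristic two, the only case of interest here.\<close>

definition symp_form :: "'a::field ^ 4 \<Rightarrow> 'a ^ 4 \<Rightarrow> 'a"
  where "symp_form x y = x $ 1 * y $ 4 + x $ 2 * y $ 3 + x $ 3 * y $ 2 + x $ 4 * y $ 1"

definition polarity :: "('a::field ^ 4) set \<Rightarrow> ('a ^ 4) set"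
  where "polarity V = {y. \<forall>x\<in>V. symp_form x y = 0}"

definition osculating_planes :: "nat \<Rightarrow> ('a::field ^ 4) set set"
  where "osculating_planes h = polarity ` pg_arc h"

text \<open>
  The class $O_d$; it is only meant for $d \in \{0,1,2,3,q+1\}$, and the value $d = q+1$ is
  a label for the arc itself.
\<close>

definition point_class :: "nat \<Rightarrow> nat \<Rightarrow> ('a::field ^ 4) set set"
  where "point_class h d =
    (if d = CARD('a) + 1 then pg_arc h
     else {P \<in> pg_points - pg_arc h. card {\<pi> \<in> osculating_planes h. P \<subseteq> \<pi>} = d})"

definition plane_class :: "nat \<Rightarrow> nat \<Rightarrow> ('a::field ^ 4) set set"
  where "plane_class h d = polarity ` point_class h d"

end

(* The translations t -> t + s and the reversal t -> 1/t of the arc are induced by linear maps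
   preserving the form, so all points of the arc behave like U_4. By duality one then counts points
   on the osculating plane X_1 = 0 at U_4. Such a point (0, c, a, b), other than U_4, lies on that
   plane and on the osculating planes of the P_t with c t^(2^h) + a t + b = 0. The left-hand side is
   additive in t up to the constant b, and bijective if exactly one of a, c vanishes; otherwise its
   kernel has exactly two elements, since gcd(n,h) = 1 makes t |-> t^(2^h - 1) a bijection of the
   nonzero elements, so there are 0 or 2 solutions, each case occurring for half of the b. *)

theory Submission
  imports Defs
begin

section \<open>Finite fields of characteristic two\<close>

text \<open>The shift by 1 permutes the field, so summing x + 1 over all x makes the cardinality
  vanish in the field; a vanishing power of 2 forces 2 = 0.\<close>

lemma two_eq_zero_of_card:
  assumes "CARD('a::{field,finite}) = 2 ^ n"
  shows "(2::'a) = 0"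
proof -
  have "(\<Sum>x\<in>UNIV. x + 1) = (\<Sum>x\<in>UNIV. x::'a)"
    by (rule sum.reindex_bij_witness[of _ "\<lambda>x. x - 1" "\<lambda>x. x + 1"]) auto
  then have "of_nat CARD('a) = (0::'a)"
    by (simp add: sum.distrib)
  then show ?thesis
    using assms by simp
qed

text \<open>Multiplication by a nonzero x permutes the nonzero elements; comparing their products
  gives x^(q-1) = 1.\<close>

lemma power_card_eq_self:
  fixes x :: "'a::{field,finite}"
  shows "x ^ CARD('a) = x"
proof (cases "x = 0")
  case False
  have "(\<Prod>y\<in>-{0}. x * y) = (\<Prod>y\<in>-{0}. y)"
    by (rule prod.reindex_bij_witness[of _ "\<lambda>y. y / x" "\<lambda>y. x * y"]) (use False in auto)
  then have "x ^ (CARD('a) - 1) = 1"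
    by (simp add: prod.distrib Compl_eq_Diff_UNIV card_Diff_subset)
  then show ?thesis
    by (metis finite_UNIV_card_ge_0 finite power_minus_mult mult_1)
qed simp

lemma add_self_eq_zero:
  fixes x :: "'a::field"
  assumes "(2::'a) = 0"
  shows "x + x = 0"
  using assms by (metis mult_2 mult_zero_left)

lemma add_eq_zero_iff_char_two:
  fixes x y :: "'a::field"
  assumes "(2::'a) = 0"
  shows "x + y = 0 \<longleftrightarrow> x = y"
  using add_self_eq_zero[OF assms] by (metis add_right_cancel)

lemma add_power_two_power:
  fixes x y :: "'a::field"
  assumes "(2::'a) = 0"
  shows "(x + y) ^ (2 ^ h) = x ^ (2 ^ h) + y ^ (2 ^ h)"
proof (induction h)
  case (Suc h)
  have "(x + y) ^ (2 ^ Suc h) = ((x + y) ^ (2 ^ h))\<^sup>2"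
    by (simp add: power_mult [symmetric] mult.commute)
  also have "\<dots> = (x ^ (2 ^ h))\<^sup>2 + (y ^ (2 ^ h))\<^sup>2"
    using assms by (simp add: Suc power2_sum)
  finally show ?case
    by (simp add: power_mult [symmetric] mult.commute)
qed simp

lemma iterate_two_power_fixed:
  fixes z :: "'a::monoid_mult"
  assumes "z ^ (2 ^ h) = z"
  shows "z ^ (2 ^ (h * k)) = z"
proof (induction k)
  case (Suc k)
  have "z ^ (2 ^ (h * Suc k)) = (z ^ (2 ^ h)) ^ (2 ^ (h * k))"
    by (simp add: power_mult [symmetric] power_add)
  then show ?case
    by (simp add: assms Suc)
qed simp

text \<open>An element fixed by the h-th iterate of squaring is also fixed by the n-th, as all
  elements are. Since n and h are coprime, squaring itself fixes it.\<close>

lemma two_power_fixed_iff: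
  fixes z :: "'a::{field,finite}"
  assumes "CARD('a) = 2 ^ n" "h > 0" "gcd n h = 1"
  shows "z ^ (2 ^ h) = z \<longleftrightarrow> z = 0 \<or> z = 1"
proof
  assume z: "z ^ (2 ^ h) = z"
  \<comment> \<open>Bezout over the naturals: u rounds of h squarings amount to v rounds of n
    squarings and one extra squaring.\<close>
  obtain u v where uv: "h * u = n * v + 1"
    using bezout_nat[of h n] assms by (auto simp: gcd.commute)
  have "z ^ (2 ^ n) = z"
    using power_card_eq_self[of z] assms(1) by simp
  then have "(z ^ (2 ^ (n * v))) ^ 2 = z\<^sup>2"
    by (simp add: iterate_two_power_fixed)
  then have "z ^ (2 ^ (h * u)) = z\<^sup>2"
    by (simp add: uv power_mult [symmetric] mult.commute)
  then have "z\<^sup>2 = z"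
    using iterate_two_power_fixed[OF z, of u] by simp
  then show "z = 0 \<or> z = 1"
    by (simp add: power2_eq_square)
qed auto

text \<open>Nonzero roots are the solutions of t^m = a with m = 2^h - 1, and the m-th power map is a
  bijection of the nonzero elements.\<close>

lemma linearized_kernel:
  fixes a :: "'a::{field,finite}"
  assumes "CARD('a) = 2 ^ n" "h > 0" "gcd n h = 1" "a \<noteq> 0"
  obtains k where "k \<noteq> 0" "{t. t ^ (2 ^ h) + t * a = 0} = {0, k}"
proof -
  note two = two_eq_zero_of_card[OF assms(1)]
  define m where "m = 2 ^ h - (1::nat)"
  have m: "x ^ (2 ^ h) = x * x ^ m" for x :: 'a
    unfolding m_def by (metis power_Suc Suc_pred' zero_less_power zero_less_numeral diff_Suc_1)
  have inj: "inj_on (\<lambda>x::'a. x ^ m) (- {0})"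
  proof (rule inj_onI)
    fix x y :: 'a
    assume "x \<in> - {0}" "y \<in> - {0}" and eq: "x ^ m = y ^ m"
    \<comment> \<open>Equal m-th powers make (x / y)^m = 1; one more factor x / y gives a fixed
      point, which is nonzero and hence 1.\<close>
    then have "(x / y) ^ (2 ^ h) = x / y"
      by (simp add: m power_divide)
    then show "x = y"
      using two_power_fixed_iff[OF assms(1-3)] \<open>x \<in> - {0}\<close> \<open>y \<in> - {0}\<close> by auto
  qed
  have "(\<lambda>x::'a. x ^ m) ` (- {0}) = - {0}"
    by (rule endo_inj_surj[OF _ _ inj]) auto
  then obtain k where k: "k \<noteq> 0" "k ^ m = a"
    using assms(4) by (metis (no_types, lifting) ComplD ComplI image_iff singletonD singletonI)
  have "t ^ (2 ^ h) + t * a = 0 \<longleftrightarrow> t \<in> {0, k}" for t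
  proof -
    have "t ^ (2 ^ h) + t * a = 0 \<longleftrightarrow> t = 0 \<or> t ^ m + k ^ m = 0"
      by (simp add: m k(2) distrib_left [symmetric])
    also have "\<dots> \<longleftrightarrow> t = 0 \<or> (t \<noteq> 0 \<and> t ^ m = k ^ m)"
      by (auto simp: add_eq_zero_iff_char_two[OF two])
    also have "\<dots> \<longleftrightarrow> t \<in> {0, k}"
      using inj k(1) by (auto simp: inj_on_def)
    finally show ?thesis .
  qed
  then show thesis
    using that[OF k(1)] by blast
qed

section \<open>Root counts of the affine polynomials b + a t + t^(2^h)\<close>

lemma sum_card_fibres:
  fixes f :: "'a::finite \<Rightarrow> 'b::finite"
  shows "(\<Sum>b\<in>UNIV. card {t. f t = b}) = CARD('a)"
  using sum.group[of UNIV UNIV f "\<lambda>_. 1::nat"] by simp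

text \<open>The number of parameters t for which the osculating plane at P_t contains the point (0,
  1, a, b).\<close>

definition num_roots :: "nat \<Rightarrow> 'a::{field,finite} \<Rightarrow> 'a \<Rightarrow> nat"
  where "num_roots h a b = card {t. b + t * a + t ^ (2 ^ h) = 0}"

text \<open>For a = 0 the equation reads t^(2^h) = b, and t^(2^h) is additive with trivial kernel,
  hence bijective on a finite field.\<close>

lemma num_roots_zero:
  fixes b :: "'a::{field,finite}"
  assumes "CARD('a) = 2 ^ n"
  shows "num_roots h 0 b = 1"
proof -
  note two = two_eq_zero_of_card[OF assms]
  have inj: "inj (\<lambda>t::'a. t ^ (2 ^ h))"
  proof (rule injI)
    fix x y :: 'a
    assume "x ^ (2 ^ h) = y ^ (2 ^ h)"
    then have "(x + y) ^ (2 ^ h) = 0"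
      by (simp add: add_power_two_power[OF two] add_self_eq_zero[OF two])
    then show "x = y"
      using add_eq_zero_iff_char_two[OF two] by simp
  qed
  then have "surj (\<lambda>t::'a. t ^ (2 ^ h))"
    by (simp add: finite_UNIV_inj_surj)
  then obtain s where "b = s ^ (2 ^ h)"
    by (rule surjE)
  then have "{t. b = t ^ (2 ^ h)} = {s}"
    using inj by (auto dest: injD)
  then show ?thesis
    by (simp add: num_roots_def add_eq_zero_iff_char_two[OF two])
qed

text \<open>The map \<open>L\<close> is additive with a kernel of two elements, so each fibre is
  empty or a coset of the kernel. The fibre sizes add up to q, which leaves q/2 fibres of each
  kind.\<close>

lemma num_roots_nonzero:
  fixes a :: "'a::{field,finite}"
  assumes "CARD('a) = 2 ^ n" "h > 0" "gcd n h = 1" "a \<noteq> 0"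
  shows "num_roots h a b \<in> {0, 2}"
    and "card {b. num_roots h a b = 0} = CARD('a) div 2"
    and "card {b. num_roots h a b = 2} = CARD('a) div 2"
proof -
  note two = two_eq_zero_of_card[OF assms(1)]
  define L where "L t = t ^ (2 ^ h) + t * a" for t :: 'a
  obtain k where k: "k \<noteq> 0" "{t. t ^ (2 ^ h) + t * a = 0} = {0, k}"
    using linearized_kernel[OF assms] .
  have Lker: "L t = 0 \<longleftrightarrow> t = 0 \<or> t = k" for t
    using k(2) unfolding L_def by blast
  have L_add: "L (s + t) = L s + L t" for s t
    by (simp add: L_def add_power_two_power[OF two] algebra_simps)
  have N: "num_roots h a b = card {t. L t = b}" for b
    unfolding num_roots_def L_def
    by (rule arg_cong[where f = card])
      (use add_eq_zero_iff_char_two[OF two] in \<open>force simp: add.assoc add.commute\<close>)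
  have dich: "num_roots h a b \<in> {0, 2}" for b
  proof (cases "\<exists>s. L s = b")
    case True
    then obtain s where s: "L s = b" by blast
    have "L t = b \<longleftrightarrow> s + t = 0 \<or> s + t = k" for t
      using Lker[of "s + t"] add_eq_zero_iff_char_two[OF two, of "L s" "L t"] s
      by (auto simp: L_add)
    also have "\<And>t. s + t = 0 \<or> s + t = k \<longleftrightarrow> t \<in> {s, s + k}"
      using add_self_eq_zero[OF two] add_eq_zero_iff_char_two[OF two]
      by (auto simp: add.assoc [symmetric])
    finally have "{t. L t = b} = {s, s + k}" by auto
    then show ?thesis
      using k(1) by (simp add: N)
  qed (simp add: N)
  then show "num_roots h a b \<in> {0, 2}" .
  \<comment> \<open>Written this way, the sum of all fibre sizes becomes twice the number of
    two-element fibres.\<close>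
  have "num_roots h a b = (if num_roots h a b = 2 then 2 else 0)" for b
    using dich[of b] by auto
  then have "(\<Sum>b\<in>UNIV. num_roots h a b) = (\<Sum>b\<in>UNIV. if num_roots h a b = 2 then 2 else 0)"
    by (intro sum.cong) auto
  then have c2: "2 * card {b. num_roots h a b = 2} = CARD('a)"
    by (simp add: N sum_card_fibres sum.If_cases)
  then show "card {b. num_roots h a b = 2} = CARD('a) div 2"
    by simp
  have "{b. num_roots h a b = 0} = - {b. num_roots h a b = 2}"
    using dich by force
  then have "card {b. num_roots h a b = 0} = CARD('a) - card {b. num_roots h a b = 2}"
    by (simp add: Compl_eq_Diff_UNIV card_Diff_subset)
  then show "card {b. num_roots h a b = 0} = CARD('a) div 2"
    using c2 by simp
qed

text \<open>The shift by one accounts for the osculating plane at U_4. The value a = 0 gives one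
  root for each b, hence q pairs with d = 2; each of the q - 1 other values of a gives q/2 pairs
  with d = 1 and q/2 with d = 3.\<close>

lemma card_num_roots:
  assumes "CARD('a::{field,finite}) = 2 ^ n" "h > 0" "gcd n h = 1"
  shows "card {(a::'a, b). num_roots h a b + 1 = d} =
    (if d = 2 then CARD('a) else if d = 1 \<or> d = 3 then (CARD('a) - 1) * (CARD('a) div 2) else 0)"
proof -
  define C where "C a = card {b. num_roots h a b + 1 = d}" for a :: 'a
  have "{(a::'a, b). num_roots h a b + 1 = d} = (SIGMA a:UNIV. {b. num_roots h a b + 1 = d})"
    by auto
  then have "card {(a::'a, b). num_roots h a b + 1 = d} = (\<Sum>a\<in>UNIV. C a)"
    by (simp add: card_SigmaI C_def)
  also have "\<dots> = C 0 + (\<Sum>a\<in>UNIV - {0}. C a)"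
    by (rule sum.remove) auto
  also have "C 0 = (if d = 2 then CARD('a) else 0)"
    by (auto simp: C_def num_roots_zero[OF assms(1)])
  also have "(\<Sum>a\<in>UNIV - {0}. C a) =
      (\<Sum>a\<in>UNIV - {0::'a}. if d = 1 \<or> d = 3 then CARD('a) div 2 else 0)"
  proof (rule sum.cong[OF refl])
    fix a :: 'a
    assume "a \<in> UNIV - {0}"
    then have a: "a \<noteq> 0" by simp
    note nr = num_roots_nonzero[OF assms a]
    consider "d = 1" | "d = 3" | "d \<noteq> 1" "d \<noteq> 3" by blast
    then show "C a = (if d = 1 \<or> d = 3 then CARD('a) div 2 else 0)"
    proof cases
      case 1
      then show ?thesis using nr(2) by (simp add: C_def)
    next
      case 2
      then have "{b. num_roots h a b + 1 = d} = {b. num_roots h a b = 2}" by auto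
      then show ?thesis using nr(3) 2 by (simp add: C_def)
    next
      case 3
      then have "{b. num_roots h a b + 1 = d} = {}" using nr(1) by force
      then show ?thesis using 3 by (simp add: C_def)
    qed
  qed
  finally show ?thesis
    by (auto simp: card_Diff_subset)
qed

section \<open>Points of the projective space\<close>

lemma subspace_span_singleton_subset:
  assumes "vec.subspace V"
  shows "vec.span {v} \<subseteq> V \<longleftrightarrow> v \<in> V"
  using assms by (metis vec.span_minimal vec.span_base empty_subsetI insert_subset singletonI subsetD)

lemma span_singleton_eq_iff:
  fixes v w :: "'a::field ^ 'n"
  shows "vec.span {v} = vec.span {w} \<longleftrightarrow> (\<exists>c. c \<noteq> 0 \<and> w = c *s v)"
proof
  assume eq: "vec.span {v} = vec.span {w}"
  have "w \<in> vec.span {v}" "v \<in> vec.span {w}"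
    using eq vec.span_base[of w "{w}"] vec.span_base[of v "{v}"] by simp_all
  then obtain c d where cd: "w = c *s v" "v = d *s w"
    unfolding vec.span_singleton by blast
  show "\<exists>c. c \<noteq> 0 \<and> w = c *s v"
  proof (cases "c = 0")
    \<comment> \<open>If c = 0, then both vectors are zero, so the factor 1 serves instead.\<close>
    case True
    then show ?thesis using cd by (intro exI[of _ 1]) auto
  qed (use cd in blast)
next
  assume "\<exists>c. c \<noteq> 0 \<and> w = c *s v"
  then obtain c where c: "c \<noteq> 0" "w = c *s v" by blast
  then have "v = inverse c *s w" by (simp add: vector_smult_assoc)
  then have "v \<in> vec.span {w}" by (metis vec.span_base vec.span_scale singletonI)
  moreover have "w \<in> vec.span {v}" by (metis c(2) vec.span_base vec.span_scale singletonI)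
  ultimately show "vec.span {v} = vec.span {w}"
    by (simp add: subspace_span_singleton_subset subset_antisym)
qed

lemma pg_points_eq: "pg_points = {vec.span {v} | v. v \<noteq> 0}"
proof (intro subset_antisym subsetI)
  fix V :: "('a ^ 4) set"
  assume "V \<in> pg_points"
  then have V: "vec.subspace V" "vec.dim V = 1" by (auto simp: pg_points_def)
  obtain B where B: "B \<subseteq> V" "vec.independent B" "V \<subseteq> vec.span B" "card B = vec.dim V"
    using vec.basis_exists by blast
  then obtain v where v: "B = {v}" using V(2) by (metis card_1_singletonE)
  have "vec.span {v} = V"
    using B V v by (simp add: subset_antisym vec.span_minimal)
  moreover have "v \<noteq> 0" using B(2) v vec.dependent_zero by blast
  ultimately show "V \<in> {vec.span {v} | v. v \<noteq> 0}" by blast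
qed (auto simp: pg_points_def vec.subspace_span)

lemma pg_points_span_iff: "vec.span {v} \<in> pg_points \<longleftrightarrow> v \<noteq> (0::'a::field ^ 4)"
  by (auto simp: pg_points_def vec.subspace_span)

lemma vector_4_eta: "vector [v $ 1, v $ 2, v $ 3, v $ 4] = (v::'a::zero ^ 4)"
  by (simp add: vec_eq_iff forall_4)

lemma vector_4_eq_iff:
  "vector [a, b, c, d] = (vector [a', b', c', d'] :: 'a::zero ^ 4) \<longleftrightarrow>
     a = a' \<and> b = b' \<and> c = c' \<and> d = d'"
  by (simp add: vec_eq_iff forall_4)

lemma smult_vector_4:
  "k *s vector [a, b, c, d] = (vector [k * a, k * b, k * c, k * d] :: 'a::field ^ 4)"
  by (simp add: vec_eq_iff forall_4)

lemma pg_point_eq_iff: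
  "pg_point a b c d = pg_point a' b' c' d' \<longleftrightarrow>
     (\<exists>k. k \<noteq> 0 \<and> a' = k * a \<and> b' = k * b \<and> c' = k * c \<and> d' = k * d)"
  by (simp add: pg_point_def span_singleton_eq_iff smult_vector_4 vector_4_eq_iff)

lemma pg_point_in_pg_points:
  "pg_point a b c d \<in> pg_points \<longleftrightarrow> \<not> (a = 0 \<and> b = 0 \<and> c = 0 \<and> d = 0)"
  by (simp add: pg_point_def pg_points_span_iff vec_eq_iff forall_4)

lemma pg_arc_subset_pg_points: "pg_arc h \<subseteq> pg_points"
  by (auto simp: pg_arc_def pg_point_in_pg_points)

lemma pg_point_arc_inj:
  "pg_point 1 s (s ^ (2 ^ h)) (s ^ (2 ^ h + 1)) = pg_point 1 t (t ^ (2 ^ h)) (t ^ (2 ^ h + 1)) \<longleftrightarrow> s = t"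
  by (auto simp: pg_point_eq_iff)

section \<open>The symplectic polarity\<close>

lemma symp_form_commute: "symp_form x y = symp_form y x"
  by (simp add: symp_form_def algebra_simps)

lemma symp_form_smult: "symp_form (c *s x) y = c * symp_form x y"
  by (simp add: symp_form_def algebra_simps)

lemma symp_form_axis:
  "symp_form x (axis 4 1) = x $ 1" "symp_form x (axis 3 1) = x $ 2"
  "symp_form x (axis 2 1) = x $ 3" "symp_form x (axis 1 1) = x $ 4"
  by (simp_all add: symp_form_def axis_def)

text \<open>Pairing with the unit vectors reads off the coordinates in reverse order.\<close>

lemma symp_form_nondegenerate:
  assumes "\<And>y. symp_form x y = symp_form x' y"
  shows "x = x'"
  using assms[of "axis 1 1"] assms[of "axis 2 1"] assms[of "axis 3 1"] assms[of "axis 4 1"]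
  by (simp add: symp_form_axis vec_eq_iff forall_4)

lemma subspace_polarity: "vec.subspace (polarity V)"
proof -
  have "symp_form x 0 = 0" "symp_form x (y + z) = symp_form x y + symp_form x z"
    "symp_form x (c *s y) = c * symp_form x y" for x y z and c :: 'a
    by (simp_all add: symp_form_def algebra_simps)
  then show ?thesis
    by (simp add: vec.subspace_def polarity_def)
qed

lemma polarity_span_singleton: "polarity (vec.span {v}) = {y. symp_form v y = 0}"
  by (auto simp: polarity_def vec.span_singleton symp_form_smult)

lemma span_subset_polarity_span:
  "vec.span {v} \<subseteq> polarity (vec.span {w}) \<longleftrightarrow> symp_form w v = 0"
  unfolding subspace_span_singleton_subset[OF subspace_polarity]
  by (simp add: polarity_span_singleton)

text \<open>Linear functionals with the same kernel are proportional, and nondegeneracy carries the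
  factor over to the vectors that represent them.\<close>

lemma inj_on_polarity: "inj_on polarity pg_points"
proof (rule inj_onI)
  fix V W :: "('a ^ 4) set"
  assume "V \<in> pg_points" "W \<in> pg_points" and eq: "polarity V = polarity W"
  then obtain v w where v: "V = vec.span {v}" "v \<noteq> 0" and w: "W = vec.span {w}" "w \<noteq> 0"
    by (auto simp: pg_points_eq)
  have ker: "symp_form v y = 0 \<longleftrightarrow> symp_form w y = 0" for y
    using eq unfolding v w polarity_span_singleton by blast
  have "\<exists>z. symp_form v z \<noteq> 0"
    using v(2) symp_form_nondegenerate[of v 0] by (auto simp: symp_form_def)
  then obtain z where z: "symp_form v z \<noteq> 0" by blast
  define c where "c = symp_form w z / symp_form v z"
  have "c \<noteq> 0" using z ker by (simp add: c_def)
  moreover have "w = c *s v"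
  proof (rule symp_form_nondegenerate)
    fix y
    have diff: "symp_form u (y - k *s z) = symp_form u y - k * symp_form u z" for u k
      by (simp add: symp_form_def algebra_simps)
    \<comment> \<open>Removing a multiple of z moves y into the common kernel, so both functionals
      are determined by their values at z; \<open>c\<close> is the ratio there.\<close>
    have "symp_form v (y - (symp_form v y / symp_form v z) *s z) = 0"
      using z unfolding diff by simp
    then have "symp_form w (y - (symp_form v y / symp_form v z) *s z) = 0"
      by (simp only: ker)
    then have "symp_form w y = symp_form v y / symp_form v z * symp_form w z"
      by (simp only: diff right_minus_eq)
    then show "symp_form w y = symp_form (c *s v) y"
      by (simp add: symp_form_smult c_def)
  qed
  ultimately show "V = W"
    unfolding v w span_singleton_eq_iff by blast
qed

section \<open>Incidence counts transferred through the polarity\<close>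

lemma card_osculating_planes_through:
  assumes "V \<in> pg_points"
  shows "card {\<pi> \<in> osculating_planes h. V \<subseteq> \<pi>} = card {P \<in> pg_arc h. V \<subseteq> polarity P}"
proof -
  have "{\<pi> \<in> osculating_planes h. V \<subseteq> \<pi>} = polarity ` {P \<in> pg_arc h. V \<subseteq> polarity P}"
    by (auto simp: osculating_planes_def)
  moreover have "inj_on polarity {P \<in> pg_arc h. V \<subseteq> polarity P}"
    by (rule inj_on_subset[OF inj_on_polarity]) (use pg_arc_subset_pg_points in auto)
  ultimately show ?thesis by (simp add: card_image)
qed

text \<open>The form is symmetric, so V lies on the polar plane of R exactly when R lies on that of
  V. Injectivity of the polarity then turns the count of planes into a count of points.\<close>

lemma card_plane_class_through:
  assumes "V \<in> pg_points"
  shows "card {\<pi> \<in> plane_class h d. V \<subseteq> \<pi>} = card {R \<in> point_class h d. R \<subseteq> polarity V}"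
proof -
  have sub: "point_class h d \<subseteq> (pg_points :: ('a ^ 4) set set)"
    using pg_arc_subset_pg_points by (auto simp: point_class_def)
  have "R \<subseteq> polarity V \<longleftrightarrow> V \<subseteq> polarity R" if R: "R \<in> pg_points" for R
  proof -
    obtain u v where "R = vec.span {u}" "V = vec.span {v}"
      using R assms unfolding pg_points_eq by blast
    then show ?thesis
      by (simp add: span_subset_polarity_span symp_form_commute)
  qed
  then have "{\<pi> \<in> plane_class h d. V \<subseteq> \<pi>} = polarity ` {R \<in> point_class h d. R \<subseteq> polarity V}"
    using sub by (auto simp: plane_class_def)
  moreover have "inj_on polarity {R \<in> point_class h d. R \<subseteq> polarity V}"
    by (rule inj_on_subset[OF inj_on_polarity]) (use sub in auto)
  ultimately show ?thesis by (simp add: card_image)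
qed

section \<open>Symmetries of the arc\<close>

lemma image_span_of_smult:
  assumes "\<And>c x. g (c *s x) = c *s g x"
  shows "g ` vec.span {v} = vec.span {g v}"
  by (auto simp: vec.span_singleton assms image_image)

text \<open>These properties suffice for \<open>g\<close> to act on points and to preserve polarity,
  arc and classes. Nondegeneracy of the form yields injectivity, and finiteness yields
  surjectivity.\<close>

locale arc_symmetry =
  fixes h :: nat and g :: "'a::{field,finite} ^ 4 \<Rightarrow> 'a ^ 4"
  assumes form: "symp_form (g x) (g y) = symp_form x y"
    and smult: "g (c *s x) = c *s g x"
    and arc_closed: "V \<in> pg_arc h \<Longrightarrow> g ` V \<in> pg_arc h"
begin

lemma inj: "inj g"
  by (rule injI) (metis form symp_form_nondegenerate)

lemma surj: "surj g"
  using inj by (simp add: finite_UNIV_inj_surj)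

text \<open>Taking images is injective and there are finitely many sets, so closure under
  \<open>g\<close> already gives equality; no inverse map has to be examined.\<close>

lemma image_eq_self:
  assumes "\<And>V. V \<in> S \<Longrightarrow> g ` V \<in> S"
  shows "(`) g ` S = S"
  using assms by (intro endo_inj_surj inj_on_image) (auto intro: inj_on_subset[OF inj])

lemma image_mem_iff:
  assumes "(`) g ` S = S"
  shows "g ` V \<in> S \<longleftrightarrow> V \<in> S"
  using assms by (metis image_iff inj inj_image_eq_iff)

lemma card_superset_image:
  assumes "(`) g ` S = S"
  shows "card {\<pi> \<in> S. g ` V \<subseteq> \<pi>} = card {\<pi> \<in> S. V \<subseteq> \<pi>}"
proof -
  have "{\<pi> \<in> S. g ` V \<subseteq> \<pi>} = (`) g ` {\<pi> \<in> S. V \<subseteq> \<pi>}"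
  proof (intro subset_antisym subsetI)
    fix \<pi>
    assume \<pi>: "\<pi> \<in> {\<pi> \<in> S. g ` V \<subseteq> \<pi>}"
    then have "\<pi> \<in> (`) g ` S"
      by (simp add: assms)
    then obtain \<rho> where "\<pi> = g ` \<rho>" "\<rho> \<in> S"
      by (rule imageE)
    then show "\<pi> \<in> (`) g ` {\<pi> \<in> S. V \<subseteq> \<pi>}"
      using \<pi> by (simp add: inj_image_subset_iff[OF inj])
  next
    fix \<pi>
    assume "\<pi> \<in> (`) g ` {\<pi> \<in> S. V \<subseteq> \<pi>}"
    then show "\<pi> \<in> {\<pi> \<in> S. g ` V \<subseteq> \<pi>}"
      using image_mem_iff[OF assms] by auto
  qed
  moreover have "inj_on ((`) g) {\<pi> \<in> S. V \<subseteq> \<pi>}"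
    by (rule inj_on_image) (rule inj_on_subset[OF inj], simp)
  ultimately show ?thesis by (simp add: card_image)
qed

lemma polarity_image: "polarity (g ` V) = g ` polarity V"
proof -
  have "y \<in> polarity (g ` V) \<longleftrightarrow> y \<in> g ` polarity V" for y
  proof -
    obtain x where "y = g x" using surj by blast
    then show ?thesis
      by (simp add: polarity_def form inj_image_mem_iff[OF inj])
  qed
  then show ?thesis by blast
qed

lemma image_polarity_image:
  assumes "(`) g ` S = S"
  shows "(`) g ` (polarity ` S) = polarity ` S"
proof -
  have "(`) g ` (polarity ` S) = polarity ` ((`) g ` S)"
    by (simp add: image_image polarity_image)
  then show ?thesis by (simp add: assms)
qed

lemma image_arc: "(`) g ` pg_arc h = pg_arc h"
  by (rule image_eq_self) (rule arc_closed)

lemma image_points: "(`) g ` pg_points = pg_points"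
proof (rule image_eq_self)
  fix V :: "('a ^ 4) set"
  assume "V \<in> pg_points"
  then obtain v where v: "V = vec.span {v}" "v \<noteq> 0" by (auto simp: pg_points_eq)
  moreover have "g v \<noteq> g 0" using v inj by (simp add: inj_eq)
  moreover have "g 0 = 0" using smult[of 0 0] by simp
  ultimately show "g ` V \<in> pg_points"
    by (simp add: image_span_of_smult smult pg_points_span_iff)
qed

text \<open>Points, arc and osculating planes are each permuted, and incidence is preserved, so the
  number of osculating planes through a point does not change.\<close>

lemma image_point_class: "(`) g ` point_class h d = point_class h d"
proof (rule image_eq_self)
  have "(`) g ` osculating_planes h = osculating_planes h"
    unfolding osculating_planes_def by (rule image_polarity_image[OF image_arc])
  then show "g ` V \<in> point_class h d" if "V \<in> point_class h d" for V
    using that image_mem_iff[OF image_arc] image_mem_iff[OF image_points]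
    by (auto simp: point_class_def card_superset_image split: if_splits)
qed

lemma card_plane_class_image:
  "card {\<pi> \<in> plane_class h d. g ` V \<subseteq> \<pi>} = card {\<pi> \<in> plane_class h d. V \<subseteq> \<pi>}"
  unfolding plane_class_def
  by (rule card_superset_image[OF image_polarity_image[OF image_point_class]])

end

text \<open>The linear map sending P_t to P_(t+s) in characteristic two; the last coordinate comes
  from expanding (t + s)^(2^h + 1).\<close>

definition arc_translate :: "nat \<Rightarrow> 'a::field \<Rightarrow> 'a ^ 4 \<Rightarrow> 'a ^ 4"
  where "arc_translate h s x = vector [x $ 1, x $ 2 + s * x $ 1, x $ 3 + s ^ (2 ^ h) * x $ 1,
    x $ 4 + s * x $ 3 + s ^ (2 ^ h) * x $ 2 + s ^ (2 ^ h + 1) * x $ 1]"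

definition reverse_coords :: "'a::zero ^ 4 \<Rightarrow> 'a ^ 4"
  where "reverse_coords x = vector [x $ 4, x $ 3, x $ 2, x $ 1]"

lemma arc_translate_smult: "arc_translate h s (c *s x) = c *s arc_translate h s x"
  by (simp add: arc_translate_def smult_vector_4 vector_4_eq_iff algebra_simps)

lemma reverse_coords_smult: "reverse_coords (c *s x) = c *s reverse_coords (x::'a::field ^ 4)"
  by (simp add: reverse_coords_def smult_vector_4)

lemma arc_translate_pg_point:
  assumes "(2::'a::field) = 0"
  shows "arc_translate h s ` pg_point 1 t (t ^ (2 ^ h)) (t ^ (2 ^ h + 1)) =
    pg_point 1 (t + s) ((t + s) ^ (2 ^ h)) ((t + s :: 'a) ^ (2 ^ h + 1))"
  unfolding pg_point_def
  by (simp add: image_span_of_smult arc_translate_smult)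
    (simp add: arc_translate_def add_power_two_power[OF assms] algebra_simps)

lemma reverse_coords_pg_point: "reverse_coords ` pg_point a b c d = pg_point d c b a"
  unfolding pg_point_def
  by (simp add: image_span_of_smult reverse_coords_smult) (simp add: reverse_coords_def)

lemma arc_symmetry_translate:
  assumes "(2::'a::{field,finite}) = 0"
  shows "arc_symmetry h (arc_translate h (s::'a))"
proof
  fix x y :: "'a ^ 4"
  define u where "u = s ^ (2 ^ h)"
  \<comment> \<open>Every term produced beyond the original form occurs an even number of times, so
    the surplus is a multiple of 2.\<close>
  have "symp_form (arc_translate h s x) (arc_translate h s y) = symp_form x y
     + 2 * (s * x $ 1 * y $ 3 + u * x $ 1 * y $ 2 + 2 * s * u * x $ 1 * y $ 1
       + u * x $ 2 * y $ 1 + s * x $ 3 * y $ 1)"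
    by (simp add: symp_form_def arc_translate_def u_def [symmetric] algebra_simps)
  then show "symp_form (arc_translate h s x) (arc_translate h s y) = symp_form x y"
    by (simp add: assms)
next
  fix V :: "('a ^ 4) set"
  have "arc_translate h s ` pg_point 0 0 0 1 = pg_point 0 0 0 1"
    unfolding pg_point_def
    by (simp add: image_span_of_smult arc_translate_smult) (simp add: arc_translate_def)
  then show "arc_translate h s ` V \<in> pg_arc h" if "V \<in> pg_arc h"
    using that arc_translate_pg_point[OF assms] unfolding pg_arc_def by auto
qed (rule arc_translate_smult)

lemma arc_symmetry_reverse: "arc_symmetry h (reverse_coords :: 'a::{field,finite} ^ 4 \<Rightarrow> 'a ^ 4)"
proof
  fix x y :: "'a ^ 4"
  show "symp_form (reverse_coords x) (reverse_coords y) = symp_form x y"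
    by (simp add: symp_form_def reverse_coords_def algebra_simps)
next
  fix V :: "('a ^ 4) set"
  assume "V \<in> pg_arc h"
  then consider "V = pg_point 0 0 0 1" | t where "V = pg_point 1 t (t ^ (2 ^ h)) (t ^ (2 ^ h + 1))"
    unfolding pg_arc_def by blast
  then consider "V = pg_point 0 0 0 1" | "V = pg_point 1 0 0 0"
    | t where "t \<noteq> 0" "V = pg_point 1 t (t ^ (2 ^ h)) (t ^ (2 ^ h + 1))"
  proof cases
    case (2 t)
    show ?thesis
    proof (cases "t = 0")
      case True
      then have "V = pg_point 1 0 0 0" using 2 by (simp add: power_0_left)
      then show ?thesis by (rule that(2))
    next
      case False
      then show ?thesis using 2 by (rule that(3))
    qed
  qed (rule that(1))
  then show "reverse_coords ` V \<in> pg_arc h"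
  proof cases
    case 1
    \<comment> \<open>The reversed U_4 is written as P_0 so that it matches the parametrization of
      the arc.\<close>
    then have "reverse_coords ` V = pg_point 1 0 (0 ^ (2 ^ h)) (0 ^ (2 ^ h + 1))"
      by (simp add: reverse_coords_pg_point power_0_left)
    then show ?thesis unfolding pg_arc_def by blast
  next
    case 2
    then show ?thesis by (simp add: reverse_coords_pg_point pg_arc_def)
  next
    case 3
    have "reverse_coords ` V = pg_point 1 (1 / t) ((1 / t) ^ (2 ^ h)) ((1 / t) ^ (2 ^ h + 1))"
      unfolding 3(2) reverse_coords_pg_point pg_point_eq_iff
      \<comment> \<open>The factor normalizes the first coordinate of the reversed point, which is
        t^(2^h + 1).\<close>
      by (rule exI[of _ "1 / t ^ (2 ^ h + 1)"]) (use 3(1) in \<open>simp add: field_simps\<close>)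
    then show ?thesis unfolding pg_arc_def by blast
  qed
qed (rule reverse_coords_smult)

lemma card_plane_class_through_arc_point:
  fixes P :: "('a::{field,finite} ^ 4) set"
  assumes "(2::'a) = 0" "P \<in> pg_arc h"
  shows "card {\<pi> \<in> plane_class h d. P \<subseteq> \<pi>} = card {\<pi> \<in> plane_class h d. pg_point 0 0 0 (1::'a) \<subseteq> \<pi>}"
proof (cases "P = pg_point 0 0 0 1")
  case False
  then obtain t where t: "P = pg_point 1 t (t ^ (2 ^ h)) (t ^ (2 ^ h + 1))"
    using assms(2) by (auto simp: pg_arc_def)
  interpret T: arc_symmetry h "arc_translate h t"
    by (rule arc_symmetry_translate[OF assms(1)])
  interpret R: arc_symmetry h "reverse_coords :: 'a ^ 4 \<Rightarrow> 'a ^ 4"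
    by (rule arc_symmetry_reverse)
  \<comment> \<open>Reversal takes U_4 to P_0, and translation by t takes P_0 to P_t.\<close>
  have "P = arc_translate h t ` reverse_coords ` pg_point 0 0 0 1"
    using arc_translate_pg_point[OF assms(1), of h t 0]
    by (simp add: t reverse_coords_pg_point power_0_left)
  then show ?thesis
    by (simp add: T.card_plane_class_image R.card_plane_class_image)
qed simp

section \<open>The osculating plane at the point $U_4$\<close>

lemma pg_point_subset_hyperplane:
  "pg_point a b c d \<subseteq> polarity (pg_point 0 0 0 1) \<longleftrightarrow> a = 0"
  unfolding pg_point_def span_subset_polarity_span by (simp add: symp_form_def)

text \<open>The polar plane of U_4 is X_1 = 0. Scaling the first nonzero coordinate to 1 leaves two
  families; the remaining case, with only X_4 nonzero, is U_4 itself.\<close>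

lemma non_arc_points_in_hyperplane:
  "{R \<in> pg_points - pg_arc h. R \<subseteq> polarity (pg_point 0 0 0 1)} =
     (\<lambda>(a, b). pg_point 0 1 a b) ` UNIV \<union> range (pg_point 0 0 (1::'a::field))"
  (is "?L = ?R")
proof (intro subset_antisym subsetI)
  fix R :: "('a ^ 4) set"
  assume R: "R \<in> ?L"
  then obtain v where "R = vec.span {v}" "v \<noteq> 0" by (auto simp: pg_points_eq)
  then obtain x b c d where Rx: "R = pg_point x b c d"
    unfolding pg_point_def by (metis vector_4_eta)
  then have x: "x = 0" using R by (simp add: pg_point_subset_hyperplane)
  have R': "R = pg_point 0 (k * b) (k * c) (k * d)" if "k \<noteq> 0" for k
    using that unfolding Rx x pg_point_eq_iff by (intro exI[of _ k]) simp
  consider "b \<noteq> 0" | "b = 0" "c \<noteq> 0" | "b = 0" "c = 0" "d \<noteq> 0"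
    using R unfolding Rx x by (auto simp: pg_point_in_pg_points)
  then show "R \<in> ?R"
  proof cases
    case 1
    then show ?thesis using R'[of "1 / b"] by auto
  next
    case 2
    then show ?thesis using R'[of "1 / c"] by auto
  next
    case 3
    then have "R \<in> pg_arc h" using R'[of "1 / d"] by (simp add: pg_arc_def)
    then show ?thesis using R by simp
  qed
next
  fix R :: "('a ^ 4) set"
  assume "R \<in> ?R"
  then obtain c a b where R: "R = pg_point 0 c a b" "c = 1 \<or> c = 0 \<and> a = 1"
    by auto
  then have "R \<in> pg_points - pg_arc h"
    by (auto simp: pg_point_in_pg_points pg_arc_def pg_point_eq_iff)
  moreover have "R \<subseteq> polarity (pg_point 0 0 0 1)"
    unfolding R(1) pg_point_subset_hyperplane by (rule refl)
  ultimately show "R \<in> ?L"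
    by blast
qed

text \<open>The equation for t says that the point lies on the polar plane of P_t; the added one is
  the polar plane of U_4, which always contains the point.\<close>

lemma card_osculating_planes_hyperplane_point:
  fixes a b c :: "'a::{field,finite}"
  assumes "c \<noteq> 0 \<or> a \<noteq> 0"
  shows "card {\<pi> \<in> osculating_planes h. pg_point 0 c a b \<subseteq> \<pi>} =
    card {t. b + t * a + t ^ (2 ^ h) * c = 0} + 1"
proof -
  define f where "f t = pg_point 1 t (t ^ (2 ^ h)) (t ^ (2 ^ h + 1))" for t :: 'a
  let ?T = "{t. b + t * a + t ^ (2 ^ h) * c = 0}"
  have U: "pg_point 0 c a b \<subseteq> polarity (pg_point 0 0 0 1)"
    by (simp add: pg_point_subset_hyperplane)
  have f: "pg_point 0 c a b \<subseteq> polarity (f t) \<longleftrightarrow> t \<in> ?T" for t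
    unfolding f_def pg_point_def span_subset_polarity_span by (simp add: symp_form_def)
  have filter_range: "{P \<in> range f \<union> {u}. Q P} = insert u (f ` {t. Q (f t)})" if "Q u" for u Q
    using that by auto
  have arc: "pg_arc h = range f \<union> {pg_point 0 0 0 1}"
    unfolding pg_arc_def f_def by (rule refl)
  have "{P \<in> pg_arc h. pg_point 0 c a b \<subseteq> polarity P} = insert (pg_point 0 0 0 1) (f ` ?T)"
    using filter_range[where Q = "\<lambda>P. pg_point 0 c a b \<subseteq> polarity P", OF U]
    unfolding arc f by simp
  moreover have "pg_point 0 0 0 1 \<notin> f ` ?T"
    by (auto simp: f_def pg_point_eq_iff)
  moreover have "inj_on f ?T"
    by (rule inj_onI) (simp only: f_def pg_point_arc_inj)
  ultimately have "card {P \<in> pg_arc h. pg_point 0 c a b \<subseteq> polarity P} = card ?T + 1"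
    by (simp add: card_image)
  then show ?thesis
    using assms by (subst card_osculating_planes_through) (auto simp: pg_point_in_pg_points)
qed

lemma card_non_arc_points_in_hyperplane:
  assumes "CARD('a::{field,finite}) = 2 ^ n" "h > 0" "gcd n h = 1" "d \<noteq> CARD('a) + 1"
  shows "card {R \<in> point_class h d. R \<subseteq> polarity (pg_point 0 0 0 (1::'a))} =
    (if d = 2 then 2 * CARD('a) else if d = 1 \<or> d = 3 then (CARD('a) - 1) * (CARD('a) div 2) else 0)"
proof -
  note two = two_eq_zero_of_card[OF assms(1)]
  let ?f = "\<lambda>(a::'a, b). pg_point 0 1 a b" and ?g = "pg_point 0 0 (1::'a)"
  let ?A = "{(a::'a, b). num_roots h a b + 1 = d}" and ?B = "{b::'a. d = 2}"
  have f: "card {\<pi> \<in> osculating_planes h. ?f ab \<subseteq> \<pi>} = d \<longleftrightarrow> ab \<in> ?A" for ab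
    by (cases ab) (simp add: card_osculating_planes_hyperplane_point num_roots_def)
  \<comment> \<open>For (0, 0, 1, b) the equation b + t = 0 has exactly one root, so all q points of
    this family have d = 2; they raise that count from q to 2q.\<close>
  have g: "card {\<pi> \<in> osculating_planes h. ?g b \<subseteq> \<pi>} = d \<longleftrightarrow> b \<in> ?B" for b
    by (auto simp: card_osculating_planes_hyperplane_point add_eq_zero_iff_char_two[OF two])
  have "{R \<in> point_class h d. R \<subseteq> polarity (pg_point 0 0 0 1)} =
      {R \<in> ?f ` UNIV \<union> range ?g. card {\<pi> \<in> osculating_planes h. R \<subseteq> \<pi>} = d}"
    using assms(4) unfolding point_class_def non_arc_points_in_hyperplane[of h, symmetric] by auto
  also have "\<dots> = ?f ` ?A \<union> ?g ` ?B"
    using f g by blast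
  finally have "card {R \<in> point_class h d. R \<subseteq> polarity (pg_point 0 0 0 (1::'a))} =
      card (?f ` ?A \<union> ?g ` ?B)" by simp
  also have "\<dots> = card (?f ` ?A) + card (?g ` ?B)"
    by (rule card_Un_disjoint) (auto simp: pg_point_eq_iff)
  also have "card (?f ` ?A) = card ?A"
    by (rule card_image) (auto simp: inj_on_def pg_point_eq_iff)
  also have "card (?g ` ?B) = card ?B"
    by (rule card_image) (auto simp: inj_on_def pg_point_eq_iff)
  finally show ?thesis
    unfolding card_num_roots[OF assms(1-3)] by simp
qed

text \<open>Each P_t has first coordinate 1 and so misses the plane X_1 = 0.\<close>

lemma arc_points_in_hyperplane:
  "{R \<in> pg_arc h. R \<subseteq> polarity (pg_point 0 0 0 1)} = {pg_point 0 0 0 (1::'a::field)}"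
proof -
  have "R \<in> pg_arc h \<and> R \<subseteq> polarity (pg_point 0 0 0 1) \<longleftrightarrow> R = pg_point 0 0 0 1" for R :: "('a ^ 4) set"
    using pg_point_subset_hyperplane unfolding pg_arc_def by (metis (no_types, lifting) UnCI UnE
        image_iff singletonD singletonI zero_neq_one)
  then show ?thesis
    by simp
qed

theorem proposition3p7:
  fixes n h q d :: nat and P :: "('a::{field,finite} ^ 4) set"
  assumes "q = CARD('a)" and "q = 2 ^ n" and "n \<ge> 3"
    and "h > 0" and "gcd n h = 1"
    and "P \<in> pg_arc h"
    and "d \<in> {0, 1, 2, 3, q + 1}"
  shows "card {\<pi> \<in> plane_class h d. P \<subseteq> \<pi>} =
    (if d = q + 1 then 1
     else if d = 0 then 0
     else if d \<in> {1, 3} then q * (q - 1) div 2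
     else 2 * q)"
proof -
  have card: "CARD('a) = 2 ^ n" using assms(1,2) by simp
  have "card {\<pi> \<in> plane_class h d. P \<subseteq> \<pi>} = card {\<pi> \<in> plane_class h d. pg_point 0 0 0 (1::'a) \<subseteq> \<pi>}"
    by (rule card_plane_class_through_arc_point[OF two_eq_zero_of_card[OF card] assms(6)])
  also have "\<dots> = card {R \<in> point_class h d. R \<subseteq> polarity (pg_point 0 0 0 (1::'a))}"
    by (rule card_plane_class_through) (simp add: pg_point_in_pg_points)
  also have "\<dots> = (if d = q + 1 then 1 else if d = 0 then 0
     else if d \<in> {1, 3} then q * (q - 1) div 2 else 2 * q)"
  proof (cases "d = q + 1")
    case True
    then show ?thesis
      by (simp add: point_class_def assms(1) arc_points_in_hyperplane)
  next
    case False
    \<comment> \<open>Evenness lets the halving act on the factor q, matching the form of the point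
      count.\<close>
    have "even q" using assms(2,3) by simp
    then have "q * (q - 1) div 2 = (q - 1) * (q div 2)"
      by (metis div_mult_swap mult.commute)
    then show ?thesis
      using False assms(1,7) card_non_arc_points_in_hyperplane[OF card assms(4,5), of d] by auto
  qed
  finally show ?thesis .
qed

end
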